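(* Let $p$ be a prime and let $(w_n)_{n\ge 1}$ be a sequence of positive integers such that $\lim_{n\to\infty}\left(w_n-\log_p(n)\right)=+\infty$. For each $n$, let $\overline{\mathbf{B}}_n$ be a uniform random element of the set $$\{B\in M_n(\mathbb{F}_p): B(i,j)=0\text{ for all } i,j\text{ such that } |i-j|>w_n\}.$$ Then for all nonnegative integers $k$, $$\lim_{n\to\infty}\mathbb{P}(\dim\ker\overline{\mathbf{B}}_n=k)=p^{-k^2}\prod_{j=1}^{k}\left(1-p^{-j}\right)^{-2}\prod_{j=1}^{\infty}\left(1-p^{-j}\right).$$
   Context: $\ker\overline{\mathbf{B}}_n=\{v\in\mathbb{F}_p^n:\overline{\mathbf{B}}_nv=0\}$, and $\dim$ is dimension over $\mathbb{F}_p$. *)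

theory Defs
  imports
    "HOL-Probability.Probability_Mass_Function"
    "Jordan_Normal_Form.Matrix_Kernel"
    "Berlekamp_Zassenhaus.Finite_Field"
begin

(* Indices run over 0..<n rather than 1..n; the band condition is invariant under this shift.
   The difference is taken in int, since subtraction on nat truncates. *)
definition band_mats :: "nat \<Rightarrow> nat \<Rightarrow> 'a :: zero mat set" where
  "band_mats n w = {B \<in> carrier_mat n n.
     \<forall>i < n. \<forall>j < n. \<bar>int i - int j\<bar> > int w \<longrightarrow> B $$ (i, j) = 0}"

(* pmf_of_set is specified only for finite nonempty sets. *)
lemma band_mats_nonempty: "band_mats n w \<noteq> {}"
proof -
  have "0\<^sub>m n n \<in> band_mats n w"
    by (simp add: band_mats_def)
  then show ?thesis by blast
qed

lemma finite_band_mats: "finite (band_mats n w :: 'a :: {zero, finite} mat set)"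
proof (rule finite_subset)
  let ?S = "{f :: nat \<times> nat \<Rightarrow> 'a. \<forall>x. (x \<in> {..<n} \<times> {..<n} \<longrightarrow> f x \<in> UNIV) \<and>
    (x \<notin> {..<n} \<times> {..<n} \<longrightarrow> f x = 0)}"
  show "finite (mat n n ` ?S)"
    by (intro finite_imageI finite_set_of_finite_funs) auto
  show "band_mats n w \<subseteq> mat n n ` ?S"
  proof
    fix B :: "'a mat" assume "B \<in> band_mats n w"
    moreover define f where "f = (\<lambda>x. if x \<in> {..<n} \<times> {..<n} then B $$ x else 0)"
    ultimately have "B = mat n n f"
      by (intro eq_matI) (auto simp: band_mats_def)
    moreover have "f \<in> ?S"
      by (simp add: f_def)
    ultimately show "B \<in> mat n n ` ?S"
      by blast
  qed
qed

end

(* Let K(i) be the space of vectors annihilated by the first i rows; its size shrinks by the factor p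
   unless row i + 1 annihilates K(i). A row drawn uniformly from F_p^S annihilates K with probability
   1 / |pi_S K|, where pi_S restricts vectors to the coordinates in S. If the columns lying entirely
   to the left of the window of the new row are independent, then pi_S is injective on the vectors
   of K(i) that vanish to the right of the window, so that |pi_S K(i)| >= p^(w+1); as soon as the
   window reaches column n, even |pi_S K(i)| = |K(i)|. By this and its transpose, the first failure of
   independence among the first n - w rows and columns has probability at most 2 n p^-(w+1), which
   tends to 0. Otherwise |K(i)| performs over the last w steps the Markov chain of a uniform w x w
   matrix, whose corank distribution has a closed form that converges. *)
theory Submission
  imports Defs "HOL-Probability.Product_PMF" "HOL-Real_Asymp.Real_Asymp"
begin

subsection \<open>Linear algebra over a finite field by counting\<close>

text \<open>Coordinates in a finite basis identify the space with the functions from the basis to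
  the field. This turns dimension into a count, so that kernels can be compared by
  cardinality.\<close>

lemma card_vectorspace:
  assumes "vectorspace K V" and "finite (carrier K)" and "vectorspace.fin_dim K V"
  shows "card (carrier V) = card (carrier K) ^ vectorspace.dim K V"
proof -
  interpret vectorspace K V
    by fact
  obtain S where S: "finite S" "basis S"
    using finite_basis_exists[OF assms(3)] by blast
  then have sub: "S \<subseteq> carrier V"
    by (simp add: basis_def)
  have ex1: "\<exists>!a. a \<in> S \<rightarrow>\<^sub>E carrier K \<and> lincomb a S = v" if "v \<in> carrier V" for v
    using basis_criterion[OF S(1) sub] S(2) that by blast
  have "bij_betw (\<lambda>a. lincomb a S) (S \<rightarrow>\<^sub>E carrier K) (carrier V)"
  proof (rule bij_betw_imageI)
    have cl: "lincomb a S \<in> carrier V" if "a \<in> S \<rightarrow>\<^sub>E carrier K" for a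
      using that sub by (intro lincomb_closed) auto
    show "inj_on (\<lambda>a. lincomb a S) (S \<rightarrow>\<^sub>E carrier K)"
      using ex1 cl by (intro inj_onI) metis
    show "(\<lambda>a. lincomb a S) ` (S \<rightarrow>\<^sub>E carrier K) = carrier V"
      using ex1 cl by auto (metis (no_types, lifting) image_eqI)
  qed
  then have "card (carrier V) = card (S \<rightarrow>\<^sub>E carrier K)"
    by (metis bij_betw_same_card)
  also have "\<dots> = card (carrier K) ^ card S"
    using S(1) by (simp add: card_PiE)
  also have "card S = dim"
    using dim_basis S by simp
  finally show ?thesis .
qed

lemma (in kernel) card_mat_kernel:
  assumes "finite (UNIV :: 'a set)"
  shows "card (mat_kernel A) = CARD('a) ^ dim"
proof -
  have "mat_kernel A \<subseteq> vec_of_list ` {xs. set xs \<subseteq> UNIV \<and> length xs = nc}"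
  proof
    fix v assume "v \<in> mat_kernel A"
    then have "dim_vec v = nc"
      using A by (auto simp: mat_kernel_def)
    then show "v \<in> vec_of_list ` {xs. set xs \<subseteq> UNIV \<and> length xs = nc}"
      by (intro image_eqI[of _ _ "list_of_vec v"]) (auto simp: vec_list)
  qed
  then have "finite (mat_kernel A)"
    by (rule finite_subset) (intro finite_imageI finite_lists_length_eq assms)
  \<comment> \<open>The kernel is finite, so it can serve as its own finite generating set.\<close>
  then have "Ker.fin_dim"
    unfolding Ker.fin_dim_def using Ker.in_own_span[of "mat_kernel A"] Ker.span_is_subset2[of "mat_kernel A"]
    by blast
  then show ?thesis
    using card_vectorspace[OF Ker.vectorspace_axioms] assms by simp
qed

text \<open>Vectors are functions on all naturals that vanish outside the relevant indices, so that
  restriction to a window and inclusion of coordinate subspaces need no change of length.\<close>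

definition supported :: "nat set \<Rightarrow> (nat \<Rightarrow> 'a :: zero) set" where
  "supported S = {v. \<forall>j. j \<notin> S \<longrightarrow> v j = 0}"

lemma supported_eq_PiE_dflt: "supported S = PiE_dflt S 0 (\<lambda>_. UNIV)"
  by (auto simp: supported_def PiE_dflt_def)

lemma finite_supported [simp]:
  "finite S \<Longrightarrow> finite (supported S :: (nat \<Rightarrow> 'a :: {zero, finite}) set)"
  unfolding supported_eq_PiE_dflt by (rule finite_PiE_dflt) auto

lemma card_supported:
  "finite S \<Longrightarrow> card (supported S :: (nat \<Rightarrow> 'a :: {zero, finite}) set) = CARD('a) ^ card S"
  unfolding supported_eq_PiE_dflt by (subst card_PiE_dflt) auto

definition lin_subspace :: "(nat \<Rightarrow> 'a :: field) set \<Rightarrow> bool" where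
  "lin_subspace K \<longleftrightarrow> (\<lambda>_. 0) \<in> K \<and> (\<forall>u\<in>K. \<forall>v\<in>K. \<forall>c. (\<lambda>j. u j + c * v j) \<in> K)"

definition lin_functional :: "((nat \<Rightarrow> 'a :: field) \<Rightarrow> 'a) \<Rightarrow> bool" where
  "lin_functional \<phi> \<longleftrightarrow> (\<forall>u v c. \<phi> (\<lambda>j. u j + c * v j) = \<phi> u + c * \<phi> v)"

lemma lin_subspaceD0: "lin_subspace K \<Longrightarrow> (\<lambda>_. 0) \<in> K"
  by (simp add: lin_subspace_def)

lemma lin_subspaceD: "lin_subspace K \<Longrightarrow> u \<in> K \<Longrightarrow> v \<in> K \<Longrightarrow> (\<lambda>j. u j + c * v j) \<in> K"
  by (simp add: lin_subspace_def)

lemma lin_functionalD: "lin_functional \<phi> \<Longrightarrow> \<phi> (\<lambda>j. u j + c * v j) = \<phi> u + c * \<phi> v"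
  by (simp add: lin_functional_def)

lemma lin_functional_0: "lin_functional \<phi> \<Longrightarrow> \<phi> (\<lambda>_. 0) = 0"
  using lin_functionalD[of \<phi> "\<lambda>_. 0" "-1" "\<lambda>_. 0"] by simp

lemma lin_subspace_supported: "lin_subspace (supported S)"
  by (auto simp: lin_subspace_def supported_def)

text \<open>Translation by a multiple of \<open>v\<close> carries the zero fibre of
  \<open>\<phi>\<close> onto any other fibre, so all fibres have equal size.\<close>

lemma card_kernel_nonzero:
  fixes \<phi> :: "(nat \<Rightarrow> 'a :: {field, finite}) \<Rightarrow> 'a"
  assumes "finite K" and K: "lin_subspace K" and \<phi>: "lin_functional \<phi>"
    and v: "v \<in> K" "\<phi> v \<noteq> 0"
  shows "CARD('a) * card {u \<in> K. \<phi> u = 0} = card K"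
proof -
  have fib: "card {u \<in> K. \<phi> u = c} = card {u \<in> K. \<phi> u = 0}" for c
  proof (rule bij_betw_same_card[symmetric])
    define d where "d = c / \<phi> v"
    have d: "d * \<phi> v = c"
      using v by (simp add: d_def)
    have *: "\<phi> (\<lambda>j. u j + d * v j) = \<phi> u + c" "\<phi> (\<lambda>j. u j + - d * v j) = \<phi> u - c" for u
      using lin_functionalD[OF \<phi>, of u d v] lin_functionalD[OF \<phi>, of u "- d" v]
      by (simp_all only: minus_mult_left[symmetric] d) simp_all
    have cl: "(\<lambda>j. u j + e * v j) \<in> K" if "u \<in> K" for u e
      using lin_subspaceD[OF K that v(1)] .
    show "bij_betw (\<lambda>u j. u j + d * v j) {u \<in> K. \<phi> u = 0} {u \<in> K. \<phi> u = c}"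
    proof (rule bij_betwI[where g = "\<lambda>u j. u j + - d * v j"])
      show "(\<lambda>u j. u j + d * v j) \<in> {u \<in> K. \<phi> u = 0} \<rightarrow> {u \<in> K. \<phi> u = c}"
        using cl *(1) by auto
      show "(\<lambda>u j. u j + - d * v j) \<in> {u \<in> K. \<phi> u = c} \<rightarrow> {u \<in> K. \<phi> u = 0}"
        using cl[of _ "- d"] *(2) by (auto simp del: mult_minus_left)
    qed auto
  qed
  have "card K = card (\<Union>c\<in>UNIV. {u \<in> K. \<phi> u = c})"
    by (rule arg_cong[where f = card]) auto
  also have "\<dots> = (\<Sum>c\<in>UNIV. card {u \<in> K. \<phi> u = c})"
    using assms(1) by (intro card_UN_disjoint) auto
  also have "\<dots> = CARD('a) * card {u \<in> K. \<phi> u = 0}"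
    by (subst sum.cong[OF refl fib]) simp
  finally show ?thesis ..
qed

definition dot :: "nat set \<Rightarrow> (nat \<Rightarrow> 'a :: field) \<Rightarrow> (nat \<Rightarrow> 'a) \<Rightarrow> 'a" where
  "dot S u v = (\<Sum>j\<in>S. u j * v j)"

lemma lin_functional_dot: "lin_functional (dot S u)"
  by (simp add: lin_functional_def dot_def sum.distrib sum_distrib_left distrib_left mult.left_commute)

lemma dot_commute: "dot S u v = dot S v u"
  by (simp add: dot_def mult.commute)

definition proj :: "nat set \<Rightarrow> (nat \<Rightarrow> 'a :: zero) \<Rightarrow> nat \<Rightarrow> 'a" where
  "proj S v = (\<lambda>j. if j \<in> S then v j else 0)"

lemma dot_proj: "dot S r (proj S v) = dot S r v"
  by (simp add: dot_def proj_def)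

text \<open>One equation shrinks a subspace by a factor of at most \<open>CARD('a)\<close>;
  iteration bounds the solution set from below without any notion of rank.\<close>

lemma card_kernel_ge:
  fixes \<phi> :: "nat \<Rightarrow> (nat \<Rightarrow> 'a :: {field, finite}) \<Rightarrow> 'a"
  assumes "finite K" and "lin_subspace K" and "\<And>i. lin_functional (\<phi> i)"
  shows "card K \<le> CARD('a) ^ m * card {v \<in> K. \<forall>i<m. \<phi> i v = 0}"
proof (induction m)
  case (Suc m)
  let ?L = "{v \<in> K. \<forall>i<m. \<phi> i v = 0}"
  have eq: "{v \<in> K. \<forall>i<Suc m. \<phi> i v = 0} = {v \<in> ?L. \<phi> m v = 0}"
    by (auto simp: less_Suc_eq)
  have L: "lin_subspace ?L"
    using assms(2,3) by (auto simp: lin_subspace_def lin_functional_0 lin_functional_def)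
  have "card ?L \<le> CARD('a) * card {v \<in> ?L. \<phi> m v = 0}"
  proof (cases "\<exists>v\<in>?L. \<phi> m v \<noteq> 0")
    case True
    then show ?thesis
      using card_kernel_nonzero[OF _ L assms(3)] assms(1) by force
  next
    case False
    then have "{v \<in> ?L. \<phi> m v = 0} = ?L"
      by auto
    then show ?thesis
      by simp
  qed
  then have "CARD('a) ^ m * card ?L \<le> CARD('a) ^ m * (CARD('a) * card {v \<in> ?L. \<phi> m v = 0})"
    by (rule mult_le_mono2)
  with Suc have "card K \<le> CARD('a) ^ m * (CARD('a) * card {v \<in> ?L. \<phi> m v = 0})"
    by (rule le_trans)
  then show ?case
    unfolding eq by (simp only: power_Suc mult_ac)
qed simp

(* Double counting of the orthogonal pairs (r, v): a nonzero vector is orthogonal to exactly one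
   q-th of any subspace that it does not annihilate. *)
lemma card_annihilator_supported:
  fixes L :: "(nat \<Rightarrow> 'a :: {field, finite}) set"
  assumes S: "finite S" and L: "lin_subspace L" "L \<subseteq> supported S"
  shows "card {r \<in> supported S. \<forall>v\<in>L. dot S r v = 0} * card L = CARD('a) ^ card S"
proof -
  let ?q = "CARD('a)" and ?V = "supported S :: (nat \<Rightarrow> 'a) set"
  let ?N = "{r \<in> ?V. \<forall>v\<in>L. dot S r v = 0}"
  have q: "?q > 1"
    using card_mono[of "UNIV :: 'a set" "{0, 1}"] by simp
  have q_split: "?q * x = (?q - 1) * x + x" for x
    by (metis Suc_diff_1 add.commute mult_Suc zero_less_card_finite)
  have finL: "finite L"
    by (rule finite_subset[OF L(2) finite_supported[OF S]])
  have row: "?q * card {v \<in> L. dot S r v = 0} = (if r \<in> ?N then ?q * card L else card L)" if "r \<in> ?V" for r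
  proof (cases "r \<in> ?N")
    case True
    then have "{v \<in> L. dot S r v = 0} = L"
      by blast
    then show ?thesis
      using True by (simp only: if_True)
  next
    case False
    with that obtain v where "v \<in> L" "dot S r v \<noteq> 0"
      by blast
    then have "?q * card {v \<in> L. dot S r v = 0} = card L"
      by (rule card_kernel_nonzero[OF finL L(1) lin_functional_dot])
    then show ?thesis
      using False by (simp only: if_False)
  qed
  have col: "?q * card {r \<in> ?V. dot S r v = 0} = (if v = (\<lambda>_. 0) then ?q * card ?V else card ?V)" if "v \<in> L" for v
  proof (cases "v = (\<lambda>_. 0)")
    case True
    then show ?thesis
      by (simp add: dot_def)
  next
    case False
    then obtain j where j: "v j \<noteq> 0"
      by auto
    then have "j \<in> S"
      using that L(2) by (auto simp: supported_def)
    \<comment> \<open>The unit vector at a nonzero coordinate of \<open>v\<close> shows that pairing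
      with \<open>v\<close> is not identically zero on \<open>?V\<close>.\<close>
    define u :: "nat \<Rightarrow> 'a" where "u = (\<lambda>i. if i = j then 1 else 0)"
    have "u \<in> ?V"
      using \<open>j \<in> S\<close> by (auto simp: u_def supported_def)
    moreover have "dot S v u = v j"
      using \<open>j \<in> S\<close> S by (simp add: dot_def u_def if_distrib sum.delta cong: if_cong)
    ultimately have "?q * card {r \<in> ?V. dot S v r = 0} = card ?V"
      using card_kernel_nonzero[OF finite_supported[OF S] lin_subspace_supported lin_functional_dot, of u S v] j
      by simp
    with False show ?thesis
      by (simp add: dot_commute[of S v])
  qed
  have "(\<Sum>r\<in>?V. card {v \<in> L. dot S r v = 0}) = (\<Sum>v\<in>L. card {r \<in> ?V. dot S r v = 0})"
    using sum.swap_restrict[of ?V L "\<lambda>_ _. 1 :: nat" "\<lambda>r v. dot S r v = 0"] S finL by simp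
  then have "(\<Sum>r\<in>?V. ?q * card {v \<in> L. dot S r v = 0}) = (\<Sum>v\<in>L. ?q * card {r \<in> ?V. dot S r v = 0})"
    by (simp add: sum_distrib_left[symmetric])
  then have eq: "(\<Sum>r\<in>?V. if r \<in> ?N then ?q * card L else card L)
      = (\<Sum>v\<in>L. if v = (\<lambda>_. 0) then ?q * card ?V else card ?V)"
    by (simp only: row col cong: sum.cong)
  \<comment> \<open>Splitting \<open>?q * x\<close> into \<open>(?q - 1) * x + x\<close> makes the
    summand \<open>card ?V * card L\<close> appear in both counts, where it cancels.\<close>
  have "(\<Sum>r\<in>?V. if r \<in> ?N then ?q * card L else card L)
      = (\<Sum>r\<in>?V. (if r \<in> ?N then (?q - 1) * card L else 0) + card L)"
    by (intro sum.cong refl) (simp add: q_split)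
  also have "\<dots> = (?q - 1) * (card ?N * card L) + card ?V * card L"
    using S by (simp add: sum.distrib sum.If_cases Int_def conj_ac)
  finally have lhs: "(\<Sum>r\<in>?V. if r \<in> ?N then ?q * card L else card L) = \<dots>" .
  have "(\<Sum>v\<in>L. if v = (\<lambda>_. 0) then ?q * card ?V else card ?V)
      = (\<Sum>v\<in>L. (if v = (\<lambda>_. 0) then (?q - 1) * card ?V else 0) + card ?V)"
    by (intro sum.cong refl) (simp add: q_split)
  also have "\<dots> = (?q - 1) * card ?V + card ?V * card L"
    using finL lin_subspaceD0[OF L(1)] by (simp add: sum.distrib sum.delta)
  finally have "(?q - 1) * (card ?N * card L) = (?q - 1) * card ?V"
    using lhs eq by linarith
  then show ?thesis
    using q S by (simp add: card_supported)
qed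

text \<open>\<open>dot S\<close> reads only coordinates in \<open>S\<close>, so \<open>K\<close> may
  be replaced by its image under \<open>proj S\<close>, a subspace of
  \<open>supported S\<close>.\<close>

lemma card_annihilator:
  fixes K :: "(nat \<Rightarrow> 'a :: {field, finite}) set"
  assumes "finite S" and "lin_subspace K"
  shows "card {r \<in> supported S. \<forall>v\<in>K. dot S r v = 0} * card (proj S ` K) = CARD('a) ^ card S"
proof -
  have "lin_subspace (proj S ` K)"
    unfolding lin_subspace_def
  proof (intro conjI ballI allI)
    show "(\<lambda>_. 0) \<in> proj S ` K"
      by (rule image_eqI[OF _ lin_subspaceD0[OF assms(2)]]) (auto simp: proj_def)
    fix u v c assume "u \<in> proj S ` K" "v \<in> proj S ` K"
    then obtain u' v' where *: "u' \<in> K" "v' \<in> K" "u = proj S u'" "v = proj S v'"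
      by auto
    show "(\<lambda>j. u j + c * v j) \<in> proj S ` K"
      by (rule image_eqI[OF _ lin_subspaceD[OF assms(2) *(1,2), of c]]) (auto simp: * proj_def)
  qed
  moreover have "proj S ` K \<subseteq> supported S"
    by (auto simp: proj_def supported_def)
  ultimately show ?thesis
    using card_annihilator_supported[OF assms(1), of "proj S ` K"] by (simp add: dot_proj)
qed

subsection \<open>Exposing a band matrix row by row\<close>

definition window :: "nat \<Rightarrow> nat \<Rightarrow> nat \<Rightarrow> nat set" where
  "window n w i = {j. j < n \<and> i \<le> j + w \<and> j \<le> i + w}"

text \<open>Entries outside the n by n square are forced to 0, so that the set is finite and in
  bijection with the band matrices; a row is replaced by function update.\<close>

definition band :: "nat \<Rightarrow> nat \<Rightarrow> (nat \<Rightarrow> nat \<Rightarrow> 'a :: zero) set" where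
  "band n w = {B. \<forall>i. B i \<in> supported (if i < n then window n w i else {})}"

definition ker :: "nat \<Rightarrow> (nat \<Rightarrow> nat \<Rightarrow> 'a :: field) \<Rightarrow> nat \<Rightarrow> (nat \<Rightarrow> 'a) set" where
  "ker n B m = {v \<in> supported {..<n}. \<forall>i<m. dot {..<n} (B i) v = 0}"

text \<open>By duality, row \<open>m\<close> lies in the span of the earlier rows; the form through
  the kernel is the one that can be counted.\<close>

definition dep_row :: "nat \<Rightarrow> (nat \<Rightarrow> nat \<Rightarrow> 'a :: field) \<Rightarrow> nat \<Rightarrow> bool" where
  "dep_row n B m \<longleftrightarrow> (\<forall>v\<in>ker n B m. dot {..<n} (B m) v = 0)"

text \<open>The columns below \<open>m - w\<close> are those left of the window of row
  \<open>m\<close>; the condition is their linear independence within the first \<open>m\<close>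
  rows. For \<open>m \<le> w\<close> truncation leaves no column and the condition is void.\<close>

definition indep_cols :: "nat \<Rightarrow> nat \<Rightarrow> (nat \<Rightarrow> nat \<Rightarrow> 'a :: field) \<Rightarrow> nat \<Rightarrow> bool" where
  "indep_cols n w B m \<longleftrightarrow> ker n B m \<inter> supported {..<m - w} \<subseteq> {\<lambda>_. 0}"

lemma finite_window [simp]: "finite (window n w i)"
  by (simp add: window_def)

lemma band_iff: "B \<in> band n w \<longleftrightarrow> (\<forall>i j. \<not> (i < n \<and> j \<in> window n w i) \<longrightarrow> B i j = 0)"
  by (auto simp: band_def supported_def)

lemma band_upd: "B \<in> band n w \<Longrightarrow> m < n \<Longrightarrow> r \<in> supported (window n w m) \<Longrightarrow> B(m := r) \<in> band n w"
  by (simp add: band_def)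

lemma band_row: "B \<in> band n w \<Longrightarrow> m < n \<Longrightarrow> B m \<in> supported (window n w m)"
  by (auto simp: band_def split: if_splits dest: spec[of _ m])

lemma band_transpose: "B \<in> band n w \<Longrightarrow> (\<lambda>i j. B j i) \<in> band n w"
  by (auto simp: band_iff window_def)

lemma band_nonempty: "(\<lambda>_ _. 0) \<in> band n w"
  by (simp add: band_iff)

lemma finite_band [simp]: "finite (band n w :: (nat \<Rightarrow> nat \<Rightarrow> 'a :: {zero, finite}) set)"
proof (rule finite_subset)
  let ?V = "supported {..<n} :: (nat \<Rightarrow> 'a) set"
  show "band n w \<subseteq> {B. \<forall>i. (i \<in> {..<n} \<longrightarrow> B i \<in> ?V) \<and> (i \<notin> {..<n} \<longrightarrow> B i = (\<lambda>_. 0))}"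
    by (auto simp: band_iff supported_def window_def)
  show "finite {B. \<forall>i. (i \<in> {..<n} \<longrightarrow> B i \<in> ?V) \<and> (i \<notin> {..<n} \<longrightarrow> B i = (\<lambda>_. 0))}"
    by (intro finite_set_of_finite_funs finite_supported finite_lessThan)
qed

lemma finite_ker [simp]: "finite (ker n B m :: (nat \<Rightarrow> 'a :: {field, finite}) set)"
  unfolding ker_def by (rule finite_subset[OF _ finite_supported[OF finite_lessThan[of n]]]) blast

lemma lin_subspace_ker: "lin_subspace (ker n B m)"
  using lin_subspace_supported[of "{..<n}"]
  by (auto simp: ker_def lin_subspace_def lin_functional_0[OF lin_functional_dot]
      lin_functionalD[OF lin_functional_dot])

lemma ker_0: "ker n B 0 = supported {..<n}"
  by (simp add: ker_def)

lemma ker_Suc: "ker n B (Suc m) = {v \<in> ker n B m. dot {..<n} (B m) v = 0}"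
  by (auto simp: ker_def less_Suc_eq)

text \<open>The first rows do not include row \<open>m\<close>. This fact and the two after it let
  row \<open>m\<close> be redrawn while all earlier events stay fixed.\<close>

lemma ker_upd: "m' \<le> m \<Longrightarrow> ker n (B(m := r)) m' = ker n B m'"
  by (auto simp: ker_def)

lemma indep_cols_upd: "m' \<le> m \<Longrightarrow> indep_cols n w (B(m := r)) m' = indep_cols n w B m'"
  by (simp add: indep_cols_def ker_upd)

lemma dep_row_upd: "m' < m \<Longrightarrow> dep_row n (B(m := r)) m' = dep_row n B m'"
  by (simp add: dep_row_def ker_upd)

lemma card_ker_pos: "card (ker n B m :: (nat \<Rightarrow> 'a :: {field, finite}) set) > 0"
  using lin_subspaceD0[OF lin_subspace_ker] by (metis card_gt_0_iff empty_iff finite_ker)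

lemma card_ker_Suc:
  fixes B :: "nat \<Rightarrow> nat \<Rightarrow> 'a :: {field, finite}"
  shows "card (ker n B (Suc m)) =
    (if dep_row n B m then card (ker n B m) else card (ker n B m) div CARD('a))"
proof (cases "dep_row n B m")
  case True
  then have "ker n B (Suc m) = ker n B m"
    by (auto simp: ker_Suc dep_row_def)
  with True show ?thesis
    by simp
next
  case False
  then obtain v where "v \<in> ker n B m" "dot {..<n} (B m) v \<noteq> 0"
    by (auto simp: dep_row_def)
  then have "CARD('a) * card (ker n B (Suc m)) = card (ker n B m)"
    unfolding ker_Suc by (rule card_kernel_nonzero[OF finite_ker lin_subspace_ker lin_functional_dot])
  then have "card (ker n B m) div CARD('a) = card (ker n B (Suc m))"
    by (metis nonzero_mult_div_cancel_left zero_less_card_finite less_numeral_extra(3))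
  with False show ?thesis
    by simp
qed

lemma card_ker_indep:
  fixes B :: "nat \<Rightarrow> nat \<Rightarrow> 'a :: {field, finite}"
  assumes "m \<le> n" and "\<And>i. i < m \<Longrightarrow> \<not> dep_row n B i"
  shows "card (ker n B m) = CARD('a) ^ (n - m)"
  using assms
proof (induction m)
  case 0
  then show ?case
    by (simp add: ker_0 card_supported)
next
  case (Suc m)
  then have "card (ker n B m) = CARD('a) ^ Suc (n - Suc m)"
    by (simp add: Suc_diff_Suc)
  with Suc.prems show ?case
    by (simp add: card_ker_Suc)
qed

section \<open>Number of new rows that annihilate the current kernel\<close>

definition ann_rows :: "nat \<Rightarrow> nat \<Rightarrow> (nat \<Rightarrow> nat \<Rightarrow> 'a :: field) \<Rightarrow> nat \<Rightarrow> (nat \<Rightarrow> 'a) set" where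
  "ann_rows n w B m = {r \<in> supported (window n w m). dep_row n (B(m := r)) m}"

text \<open>A row vanishing outside the window pairs with \<open>v\<close> through window
  coordinates only, so the annihilator count applies with the window as index set.\<close>

lemma card_ann_rows:
  fixes B :: "nat \<Rightarrow> nat \<Rightarrow> 'a :: {field, finite}"
  shows "card (ann_rows n w B m) * card (proj (window n w m) ` ker n B m)
    = card (supported (window n w m) :: (nat \<Rightarrow> 'a) set)"
proof -
  have "dot {..<n} r v = dot (window n w m) r v" if "r \<in> supported (window n w m)" for r v :: "nat \<Rightarrow> 'a"
    unfolding dot_def using that
    by (intro sum.mono_neutral_right) (auto simp: supported_def window_def)
  then have "ann_rows n w B m
      = {r \<in> supported (window n w m). \<forall>v\<in>ker n B m. dot (window n w m) r v = 0}"
    by (auto simp: ann_rows_def dep_row_def ker_upd)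
  then show ?thesis
    using card_annihilator[OF finite_window lin_subspace_ker] by (simp add: card_supported)
qed

text \<open>The difference of two such vectors with equal projection vanishes on the window and to
  its right; what is left lies over the independent columns and is zero.\<close>

lemma inj_on_proj_ker:
  assumes "indep_cols n w B m"
  shows "inj_on (proj (window n w m)) (ker n B m \<inter> supported {..<Suc (m + w)})"
proof (rule inj_onI)
  fix u v assume u: "u \<in> ker n B m \<inter> supported {..<Suc (m + w)}"
    and v: "v \<in> ker n B m \<inter> supported {..<Suc (m + w)}"
    and eq: "proj (window n w m) u = proj (window n w m) v"
  define d where "d = (\<lambda>j. u j + - 1 * v j)"
  have "d \<in> ker n B m"
    using lin_subspaceD[OF lin_subspace_ker, of u n B m v "- 1"] u v by (simp add: d_def)
  moreover have "d \<in> supported {..<m - w}"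
    unfolding supported_def
  proof (intro CollectI allI impI)
    fix j assume j: "j \<notin> {..<m - w}"
    show "d j = 0"
    proof (cases "j \<in> window n w m")
      case True
      then show ?thesis
        using fun_cong[OF eq, of j] by (simp add: proj_def d_def)
    next
      case False
      with j have "j \<ge> n \<or> j \<ge> Suc (m + w)"
        by (auto simp: window_def)
      then show ?thesis
        using u v by (auto simp: d_def ker_def supported_def)
    qed
  qed
  ultimately have "d = (\<lambda>_. 0)"
    using assms by (auto simp: indep_cols_def)
  then show "u = v"
    by (auto simp: d_def fun_eq_iff)
qed

text \<open>Among the vectors supported on the first \<open>m + w + 1\<close> coordinates, which
  exist as \<open>m + w < n\<close>, the \<open>m\<close> equations leave at least
  \<open>CARD('a) ^ Suc w\<close>, and the projection is injective on them.\<close>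

lemma card_proj_ker_ge:
  fixes B :: "nat \<Rightarrow> nat \<Rightarrow> 'a :: {field, finite}"
  assumes "indep_cols n w B m" and "m + w < n"
  shows "CARD('a) ^ Suc w \<le> card (proj (window n w m) ` ker n B m)"
proof -
  let ?S = "supported {..<Suc (m + w)} :: (nat \<Rightarrow> 'a) set"
  have "supported {..<Suc (m + w)} \<subseteq> (supported {..<n} :: (nat \<Rightarrow> 'a) set)"
    using assms(2) by (auto simp: supported_def)
  then have "ker n B m \<inter> ?S = {v \<in> ?S. \<forall>i<m. dot {..<n} (B i) v = 0}"
    by (auto simp: ker_def)
  then have "card ?S \<le> CARD('a) ^ m * card (ker n B m \<inter> ?S)"
    using card_kernel_ge[OF finite_supported[OF finite_lessThan] lin_subspace_supported, of "\<lambda>i. dot {..<n} (B i)"]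
    by (simp add: lin_functional_dot)
  then have "CARD('a) ^ m * CARD('a) ^ Suc w \<le> CARD('a) ^ m * card (ker n B m \<inter> ?S)"
    by (simp add: card_supported power_add mult_ac)
  then have "CARD('a) ^ Suc w \<le> card (ker n B m \<inter> ?S)"
    by (subst (asm) mult_le_cancel1) simp
  also have "\<dots> = card (proj (window n w m) ` (ker n B m \<inter> ?S))"
    by (rule card_image[OF inj_on_proj_ker[OF assms(1)], symmetric])
  also have "\<dots> \<le> card (proj (window n w m) ` ker n B m)"
    by (intro card_mono finite_imageI finite_ker) blast
  finally show ?thesis .
qed

text \<open>The window reaches the last column, so no kernel vector extends beyond it and
  injectivity holds on the whole kernel.\<close>

lemma card_proj_ker_eq:
  assumes "indep_cols n w B m" and "n \<le> Suc (m + w)"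
  shows "card (proj (window n w m) ` ker n B m) = card (ker n B m)"
proof -
  have "ker n B m \<inter> supported {..<Suc (m + w)} = ker n B m"
    using assms(2) by (auto simp: ker_def supported_def)
  then show ?thesis
    using card_image[OF inj_on_proj_ker[OF assms(1)]] by simp
qed

section \<open>Resampling one row of a uniform band matrix\<close>

lemma sum_band_resample:
  fixes \<Psi> :: "(nat \<Rightarrow> nat \<Rightarrow> 'a :: {field, finite}) \<Rightarrow> 'b :: comm_semiring_1"
  assumes "m < n"
  shows "(\<Sum>B\<in>band n w. \<Sum>r\<in>supported (window n w m). \<Psi> (B(m := r)))
    = of_nat (card (supported (window n w m) :: (nat \<Rightarrow> 'a) set)) * (\<Sum>B\<in>band n w. \<Psi> B)"
proof -
  let ?W = "supported (window n w m) :: (nat \<Rightarrow> 'a) set" and ?M = "band n w :: (nat \<Rightarrow> nat \<Rightarrow> 'a) set"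
  have "(\<Sum>B\<in>?M. \<Sum>r\<in>?W. \<Psi> (B(m := r))) = (\<Sum>(B, r)\<in>?M \<times> ?W. \<Psi> (B(m := r)))"
    by (rule sum.cartesian_product)
  also have "\<dots> = (\<Sum>(B, r)\<in>?M \<times> ?W. \<Psi> B)"
    \<comment> \<open>Exchanging row \<open>m\<close> with the fresh row \<open>r\<close> is an
      involution on the pairs.\<close>
    by (rule sum.reindex_bij_witness[where i = "\<lambda>(B, r). (B(m := r), B m)"
          and j = "\<lambda>(B, r). (B(m := r), B m)"])
      (use assms in \<open>auto simp: band_upd band_row\<close>)
  also have "\<dots> = (\<Sum>B\<in>?M. \<Sum>r\<in>?W. \<Psi> B)"
    by (rule sum.cartesian_product[symmetric])
  also have "\<dots> = of_nat (card ?W) * (\<Sum>B\<in>?M. \<Psi> B)"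
    by (simp add: sum_distrib_left)
  finally show ?thesis .
qed

lemma card_supported_window_pos: "card (supported (window n w m) :: (nat \<Rightarrow> 'a :: {zero, finite}) set) > 0"
  by (simp add: card_supported)

text \<open>\<open>indep_cols\<close> at \<open>m\<close> depends on earlier rows only. With these
  fixed and row \<open>m\<close> redrawn, the share of annihilating rows is the inverse of the size
  of the projected kernel.\<close>

lemma card_dep_row_le:
  assumes "m + w < n"
  shows "card {B \<in> band n w :: (nat \<Rightarrow> nat \<Rightarrow> 'a) set. indep_cols n w B m \<and> dep_row n B m} * CARD('a) ^ Suc w
    \<le> card (band n w :: (nat \<Rightarrow> nat \<Rightarrow> 'a :: {field, finite}) set)"
proof -
  let ?M = "band n w :: (nat \<Rightarrow> nat \<Rightarrow> 'a) set" and ?W = "supported (window n w m) :: (nat \<Rightarrow> 'a) set"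
  let ?E = "{B \<in> ?M. indep_cols n w B m \<and> dep_row n B m}"
  let ?\<Psi> = "\<lambda>B :: nat \<Rightarrow> nat \<Rightarrow> 'a. of_bool (indep_cols n w B m \<and> dep_row n B m) :: nat"
  have E: "card ?E = (\<Sum>B\<in>?M. ?\<Psi> B)"
    by (simp add: Int_def conj_ac)
  have "card ?W * card ?E = (\<Sum>B\<in>?M. \<Sum>r\<in>?W. ?\<Psi> (B(m := r)))"
    using assms unfolding E by (subst sum_band_resample) simp_all
  also have "\<dots> = (\<Sum>B\<in>?M. of_bool (indep_cols n w B m) * card (ann_rows n w B m))"
    by (intro sum.cong refl) (auto simp: indep_cols_upd ann_rows_def Int_def)
  finally have "card ?W * card ?E * CARD('a) ^ Suc w
      = (\<Sum>B\<in>?M. of_bool (indep_cols n w B m) * (card (ann_rows n w B m) * CARD('a) ^ Suc w))"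
    by (simp only: sum_distrib_right mult.assoc)
  also have "\<dots> \<le> (\<Sum>B\<in>?M. card ?W)"
  proof (intro sum_mono)
    fix B :: "nat \<Rightarrow> nat \<Rightarrow> 'a"
    have "indep_cols n w B m \<Longrightarrow> card (ann_rows n w B m) * CARD('a) ^ Suc w \<le> card ?W"
      using card_ann_rows[of n w B m] mult_le_mono2[OF card_proj_ker_ge[OF _ assms]] by metis
    then show "of_bool (indep_cols n w B m) * (card (ann_rows n w B m) * CARD('a) ^ Suc w) \<le> card ?W"
      by (cases "indep_cols n w B m") auto
  qed
  finally have "card ?W * (card ?E * CARD('a) ^ Suc w) \<le> card ?W * card ?M"
    by (simp add: mult_ac)
  then show ?thesis
    using card_supported_window_pos[where 'a = 'a, of n w m] by (simp only: mult_le_cancel1 simp_thms)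
qed

subsection \<open>The Markov chain of kernel sizes\<close>

text \<open>The expectation of \<open>g\<close> after \<open>c\<close> steps from \<open>x\<close>,
  where a step stays at \<open>x\<close> with probability \<open>1 / x\<close> and otherwise moves
  to \<open>x div q\<close>.\<close>

fun chain :: "nat \<Rightarrow> (nat \<Rightarrow> real) \<Rightarrow> nat \<Rightarrow> nat \<Rightarrow> real" where
  "chain q g 0 x = g x"
| "chain q g (Suc c) x = chain q g c x / x + (1 - 1 / x) * chain q g c (x div q)"

text \<open>The first clause pins down the kernel size after \<open>n - w\<close> rows, where the
  chain starts; the second gives later steps their exact transition probability. Raising
  \<open>i\<close> only strengthens the condition.\<close>

definition good :: "nat \<Rightarrow> nat \<Rightarrow> nat \<Rightarrow> (nat \<Rightarrow> nat \<Rightarrow> 'a :: field) \<Rightarrow> bool" where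
  "good n w i B \<longleftrightarrow> (\<forall>m < n - w. \<not> dep_row n B m) \<and> (\<forall>m\<in>{n - w..i}. indep_cols n w B m)"

lemma chain_nonneg: "(\<And>x. g x \<ge> 0) \<Longrightarrow> chain q g c x \<ge> 0"
proof (induction c arbitrary: x)
  case (Suc c)
  have "1 / real x \<le> 1"
    by (cases "x = 0") auto
  with Suc show ?case
    by simp
qed simp

text \<open>The two weights of a step add up to 1. Hence an upper bound for the complement of an
  event is a lower bound for the event.\<close>

lemma chain_compl: "chain q (\<lambda>x. 1 - g x) c x = 1 - chain q g c x"
proof (induction c arbitrary: x)
  case (Suc c)
  show ?case
    unfolding chain.simps Suc.IH by (simp add: algebra_simps diff_divide_distrib)
qed simp

lemma good_upd: "n - w \<le> i \<Longrightarrow> good n w i (B(i := r)) = good n w i B"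
  by (auto simp: good_def dep_row_upd indep_cols_upd)

(* Once the window reaches column n, the new row annihilates ker n B i with probability exactly
   1 / card (ker n B i): this makes the size of the kernel a Markov chain. *)
lemma sum_chain_step:
  fixes g :: "nat \<Rightarrow> real"
  assumes "n - w \<le> i" "i < n"
  shows "(\<Sum>B\<in>(band n w :: (nat \<Rightarrow> nat \<Rightarrow> 'a) set).
        of_bool (good n w i B) * chain CARD('a) g c (card (ker n B (Suc i))))
    = (\<Sum>B\<in>(band n w :: (nat \<Rightarrow> nat \<Rightarrow> 'a :: {field, finite}) set).
        of_bool (good n w i B) * chain CARD('a) g (Suc c) (card (ker n B i)))"
proof -
  let ?M = "band n w :: (nat \<Rightarrow> nat \<Rightarrow> 'a) set" and ?W = "supported (window n w i) :: (nat \<Rightarrow> 'a) set"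
  let ?\<Psi> = "\<lambda>B. of_bool (good n w i B) * chain CARD('a) g c (card (ker n B (Suc i)))"
  have row: "(\<Sum>r\<in>?W. ?\<Psi> (B(i := r)))
      = card ?W * (of_bool (good n w i B) * chain CARD('a) g (Suc c) (card (ker n B i)))" for B :: "nat \<Rightarrow> nat \<Rightarrow> 'a"
  proof (cases "good n w i B")
    case True
    let ?x = "card (ker n B i)"
    have "indep_cols n w B i"
      using True assms(1) by (auto simp: good_def)
    then have "card (ann_rows n w B i) * ?x = card ?W"
      using card_ann_rows[of n w B i] assms by (simp add: card_proj_ker_eq)
    then have "real (card (ann_rows n w B i)) * ?x = card ?W"
      by (metis of_nat_mult)
    moreover have "real ?x \<noteq> 0"
      using card_ker_pos[of n B i] by linarith
    ultimately have ann: "real (card (ann_rows n w B i)) = card ?W / ?x"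
      by (metis nonzero_mult_div_cancel_right)
    have "(\<Sum>r\<in>?W. ?\<Psi> (B(i := r)))
        = (\<Sum>r\<in>?W. if r \<in> ann_rows n w B i then chain CARD('a) g c ?x
            else chain CARD('a) g c (?x div CARD('a)))"
      using True assms(1)
      by (intro sum.cong refl) (simp add: good_upd card_ker_Suc ker_upd ann_rows_def)
    also have "\<dots> = card (ann_rows n w B i) * chain CARD('a) g c ?x
        + card (?W - ann_rows n w B i) * chain CARD('a) g c (?x div CARD('a))"
    proof -
      have "?W \<inter> {r. r \<in> ann_rows n w B i} = ann_rows n w B i"
        by (auto simp: ann_rows_def)
      moreover have "?W \<inter> - {r. r \<in> ann_rows n w B i} = ?W - ann_rows n w B i"
        by auto
      ultimately show ?thesis
        by (simp add: sum.If_cases)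
    qed
    also have "real (card (?W - ann_rows n w B i)) = real (card ?W) - card (ann_rows n w B i)"
    proof -
      have sub: "ann_rows n w B i \<subseteq> ?W"
        by (auto simp: ann_rows_def)
      then have "card (ann_rows n w B i) \<le> card ?W"
        by (intro card_mono) auto
      then show ?thesis
        using card_Diff_subset[OF finite_subset[OF sub] sub] by (simp add: of_nat_diff)
    qed
    also have "card (ann_rows n w B i) * chain CARD('a) g c ?x
        + (real (card ?W) - card (ann_rows n w B i)) * chain CARD('a) g c (?x div CARD('a))
        = card ?W * (of_bool (good n w i B) * chain CARD('a) g (Suc c) ?x)"
      using True by (simp add: ann algebra_simps)
    finally show ?thesis .
  qed (simp add: good_upd assms)
  have "card ?W * (\<Sum>B\<in>?M. ?\<Psi> B) = (\<Sum>B\<in>?M. \<Sum>r\<in>?W. ?\<Psi> (B(i := r)))"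
    by (rule sum_band_resample[OF assms(2), symmetric])
  also have "\<dots> = card ?W * (\<Sum>B\<in>?M. of_bool (good n w i B) * chain CARD('a) g (Suc c) (card (ker n B i)))"
    by (simp only: row sum_distrib_left)
  finally have eq: "card ?W * (\<Sum>B\<in>?M. ?\<Psi> B)
      = card ?W * (\<Sum>B\<in>?M. of_bool (good n w i B) * chain CARD('a) g (Suc c) (card (ker n B i)))" .
  have "real (card ?W) \<noteq> 0"
    using card_supported_window_pos[where 'a = 'a, of n w i] by linarith
  from this eq show ?thesis
    by (simp only: mult_cancel_left simp_thms)
qed

text \<open>Backward induction on \<open>i\<close>: dropping goodness at the last index only
  enlarges the sum because \<open>g\<close> is nonnegative, and then the exact step moves one row
  back.\<close>

lemma sum_good_le_chain:
  fixes g :: "nat \<Rightarrow> real"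
  assumes "\<And>x. g x \<ge> 0"
  shows "(\<Sum>B\<in>(band n w :: (nat \<Rightarrow> nat \<Rightarrow> 'a :: {field, finite}) set). of_bool (good n w n B) * g (card (ker n B n)))
    \<le> card (band n w :: (nat \<Rightarrow> nat \<Rightarrow> 'a) set) * chain CARD('a) g (min n w) (CARD('a) ^ min n w)"
proof -
  let ?M = "band n w :: (nat \<Rightarrow> nat \<Rightarrow> 'a) set"
  let ?S = "\<lambda>i. \<Sum>B\<in>?M. of_bool (good n w i B) * chain CARD('a) g (n - i) (card (ker n B i))"
  have "?S n \<le> ?S (n - w)"
  proof (rule inc_induct[of "n - w" n])
    fix i assume i: "n - w \<le> i" "i < n" and IH: "?S n \<le> ?S (Suc i)"
    have "?S (Suc i) \<le> (\<Sum>B\<in>?M. of_bool (good n w i B) * chain CARD('a) g (n - Suc i) (card (ker n B (Suc i))))"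
      by (intro sum_mono mult_right_mono chain_nonneg assms) (auto simp: good_def)
    also have "\<dots> = ?S i"
      unfolding Suc_diff_Suc[OF i(2), symmetric] by (rule sum_chain_step[OF i])
    finally show "?S n \<le> ?S i"
      using IH by linarith
  qed simp_all
  also have "?S (n - w) \<le> (\<Sum>B\<in>?M. chain CARD('a) g (min n w) (CARD('a) ^ min n w))"
  proof (rule sum_mono)
    fix B :: "nat \<Rightarrow> nat \<Rightarrow> 'a"
    \<comment> \<open>Truncation covers \<open>w \<ge> n\<close> too: the chain then starts before
      any row, with \<open>n\<close> steps to go.\<close>
    have *: "n - (n - w) = min n w"
      by auto
    have "chain CARD('a) g (min n w) (CARD('a) ^ min n w) \<ge> 0"
      by (rule chain_nonneg) (rule assms)
    then show "of_bool (good n w (n - w) B) * chain CARD('a) g (n - (n - w)) (card (ker n B (n - w)))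
        \<le> chain CARD('a) g (min n w) (CARD('a) ^ min n w)"
      using card_ker_indep[of "n - w" n B] by (cases "good n w (n - w) B") (auto simp: * good_def)
  qed
  finally show ?thesis
    by simp
qed

section \<open>Independence of columns and the probability of failure\<close>

lemma cols_indep_if_no_dep:
  fixes B :: "nat \<Rightarrow> nat \<Rightarrow> 'a :: field"
  assumes "m \<le> n" and "\<And>j. j < m \<Longrightarrow> \<not> dep_row n (\<lambda>i j. B j i) j"
    and v: "v \<in> supported {..<m}" "\<And>i. i < n \<Longrightarrow> dot {..<n} (B i) v = 0"
  shows "v = (\<lambda>_. 0)"
proof (rule ccontr)
  assume "v \<noteq> (\<lambda>_. 0)"
  \<comment> \<open>Take the largest index in the support. Pairing the vanishing combination of
    columns with a vector orthogonal to all columns before \<open>j\<close> leaves only the term of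
    column \<open>j\<close>, so that column is dependent.\<close>
  define j where "j = Max {j. v j \<noteq> 0}"
  have sub: "{j. v j \<noteq> 0} \<subseteq> {..<m}"
    using v(1) by (auto simp: supported_def)
  then have fin: "finite {j. v j \<noteq> 0}"
    by (rule finite_subset) simp
  have "{j. v j \<noteq> 0} \<noteq> {}"
    using \<open>v \<noteq> (\<lambda>_. 0)\<close> by auto
  then have vj: "v j \<noteq> 0"
    using Max_in[OF fin] by (auto simp: j_def)
  have jm: "j < m"
    using vj sub by auto
  have above: "v j' = 0" if "j' > j" for j'
    using Max_ge[OF fin, of j'] that by (auto simp: j_def)
  have "dot {..<n} (\<lambda>i. B i j) u = 0" if u: "u \<in> ker n (\<lambda>i j. B j i) j" for u
  proof -
    have zero: "v j' * dot {..<n} (\<lambda>i. B i j') u = 0" if "j' \<noteq> j" for j'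
      using that u above[of j'] by (cases "j' < j") (auto simp: ker_def)
    have "0 = (\<Sum>i<n. u i * dot {..<n} (B i) v)"
      using v(2) by simp
    also have "\<dots> = (\<Sum>i<n. \<Sum>j'<n. v j' * (B i j' * u i))"
      by (simp add: dot_def sum_distrib_left mult_ac)
    also have "\<dots> = (\<Sum>j'<n. \<Sum>i<n. v j' * (B i j' * u i))"
      by (rule sum.swap)
    also have "\<dots> = (\<Sum>j'<n. v j' * dot {..<n} (\<lambda>i. B i j') u)"
      by (simp add: dot_def sum_distrib_left)
    also have "\<dots> = (\<Sum>j'<n. if j' = j then v j * dot {..<n} (\<lambda>i. B i j) u else 0)"
      using zero by (intro sum.cong refl) auto
    also have "\<dots> = v j * dot {..<n} (\<lambda>i. B i j) u"
      using jm assms(1) by (simp add: sum.delta)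
    finally show ?thesis
      using vj by simp
  qed
  then have "dep_row n (\<lambda>i j. B j i) j"
    by (simp add: dep_row_def)
  with assms(2)[OF jm] show False
    by blast
qed

text \<open>Rows from \<open>m\<close> on have their windows to the right of the first
  \<open>m - w\<close> columns, so a vector supported there and killed by the first \<open>m\<close>
  rows is killed by all rows.\<close>

lemma indep_cols_if_no_dep:
  fixes B :: "nat \<Rightarrow> nat \<Rightarrow> 'a :: field"
  assumes B: "B \<in> band n w" and "m - w \<le> n" and "\<And>j. j < m - w \<Longrightarrow> \<not> dep_row n (\<lambda>i j. B j i) j"
  shows "indep_cols n w B m"
  unfolding indep_cols_def
proof
  fix v assume v: "v \<in> ker n B m \<inter> supported {..<m - w}"
  have "dot {..<n} (B i) v = 0" for i
  proof (cases "i < m")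
    case True
    then show ?thesis
      using v by (auto simp: ker_def)
  next
    case False
    then have "j \<notin> window n w i" if "j < m - w" for j
      using that by (auto simp: window_def)
    then have "B i j * v j = 0" for j
      using B v by (cases "j < m - w") (simp_all add: band_iff supported_def)
    then show ?thesis
      by (simp add: dot_def)
  qed
  then have "v = (\<lambda>_. 0)"
    using v by (intro cols_indep_if_no_dep[OF assms(2,3)]) auto
  then show "v \<in> {\<lambda>_. 0}"
    by simp
qed

(* At the first index where a row or a column depends on its predecessors, the rows and columns
   before it are still independent. *)
lemma good_if_no_failure:
  fixes B :: "nat \<Rightarrow> nat \<Rightarrow> 'a :: field"
  assumes B: "B \<in> band n w"
    and row: "\<And>m. m + w < n \<Longrightarrow> indep_cols n w B m \<Longrightarrow> \<not> dep_row n B m"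
    and col: "\<And>m. m + w < n \<Longrightarrow> indep_cols n w (\<lambda>i j. B j i) m \<Longrightarrow> \<not> dep_row n (\<lambda>i j. B j i) m"
  shows "good n w n B"
proof -
  have *: "\<not> dep_row n B m \<and> \<not> dep_row n (\<lambda>i j. B j i) m" if "m < n - w" for m
    using that
  proof (induction m rule: less_induct)
    case (less m)
    have "indep_cols n w B m"
      using less by (intro indep_cols_if_no_dep[OF B]) auto
    moreover have "indep_cols n w (\<lambda>i j. B j i) m"
      using less by (intro indep_cols_if_no_dep[OF band_transpose[OF B]]) auto
    ultimately show ?case
      using row[of m] col[of m] less.prems by auto
  qed
  then show ?thesis
    unfolding good_def by (auto intro!: indep_cols_if_no_dep[OF B])
qed

text \<open>Union bound over at most \<open>n\<close> row failures and as many column failures, the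
  latter being images of row failures under transposition.\<close>

lemma card_not_good_le:
  "card {B \<in> band n w :: (nat \<Rightarrow> nat \<Rightarrow> 'a) set. \<not> good n w n B} * CARD('a) ^ Suc w
    \<le> 2 * n * card (band n w :: (nat \<Rightarrow> nat \<Rightarrow> 'a :: {field, finite}) set)"
proof -
  let ?M = "band n w :: (nat \<Rightarrow> nat \<Rightarrow> 'a) set"
  define F where "F m = {B \<in> ?M. indep_cols n w B m \<and> dep_row n B m}" for m
  let ?T = "\<lambda>(B :: nat \<Rightarrow> nat \<Rightarrow> 'a) i j. B j i"
  have F: "card (F m) * CARD('a) ^ Suc w \<le> card ?M" if "m < n - w" for m
    using card_dep_row_le[of m w n, where 'a = 'a] that unfolding F_def by simp
  have fin: "finite (F m)" for m
    by (simp add: F_def)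
  have "{B \<in> ?M. \<not> good n w n B} \<subseteq> (\<Union>m<n - w. F m) \<union> (\<Union>m<n - w. ?T ` F m)"
  proof
    fix B assume B: "B \<in> {B \<in> ?M. \<not> good n w n B}"
    then consider m where "m + w < n" "indep_cols n w B m" "dep_row n B m"
      | m where "m + w < n" "indep_cols n w (?T B) m" "dep_row n (?T B) m"
      using good_if_no_failure[of B n w] by blast
    then show "B \<in> (\<Union>m<n - w. F m) \<union> (\<Union>m<n - w. ?T ` F m)"
    proof cases
      case 1
      then have "B \<in> F m" "m < n - w"
        using B by (auto simp: F_def)
      then show ?thesis
        by blast
    next
      case 2
      then have "?T B \<in> F m" "m < n - w"
        using B band_transpose[of B] by (auto simp: F_def)
      moreover from this(1) have "B \<in> ?T ` F m"
        by (intro image_eqI[of _ _ "?T B"]) simp_all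
      ultimately show ?thesis
        by blast
    qed
  qed
  then have "card {B \<in> ?M. \<not> good n w n B} \<le> card ((\<Union>m<n - w. F m) \<union> (\<Union>m<n - w. ?T ` F m))"
    by (intro card_mono) (auto simp: fin)
  also have "\<dots> \<le> card (\<Union>m<n - w. F m) + card (\<Union>m<n - w. ?T ` F m)"
    by (rule card_Un_le)
  also have "\<dots> \<le> (\<Sum>m<n - w. card (F m)) + (\<Sum>m<n - w. card (?T ` F m))"
    by (intro add_mono card_UN_le) auto
  also have "\<dots> \<le> (\<Sum>m<n - w. card (F m)) + (\<Sum>m<n - w. card (F m))"
    by (intro add_left_mono sum_mono card_image_le fin)
  finally have "card {B \<in> ?M. \<not> good n w n B} * CARD('a) ^ Suc w
      \<le> 2 * (\<Sum>m<n - w. card (F m)) * CARD('a) ^ Suc w"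
    by (intro mult_le_mono1) simp
  also have "\<dots> = 2 * (\<Sum>m<n - w. card (F m) * CARD('a) ^ Suc w)"
    by (simp only: sum_distrib_right mult.assoc)
  also have "\<dots> \<le> 2 * (\<Sum>m<n - w. card ?M)"
    using F by (intro mult_le_mono2 sum_mono) simp
  also have "\<dots> \<le> 2 * n * card ?M"
    by simp
  finally show ?thesis .
qed

text \<open>Up to the bad matrices, the chain bounds every event from above. Applied to
  \<open>X\<close> and to its complement, whose counts add up to the whole, this controls the error
  on both sides.\<close>

lemma band_kernel_prob_approx:
  "\<bar>card {B \<in> band n w :: (nat \<Rightarrow> nat \<Rightarrow> 'a) set. card (ker n B n) \<in> X} / card (band n w :: (nat \<Rightarrow> nat \<Rightarrow> 'a :: {field, finite}) set)
      - chain CARD('a) (indicator X) (min n w) (CARD('a) ^ min n w)\<bar> \<le> 2 * real n / real CARD('a) ^ Suc w"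
proof -
  let ?M = "band n w :: (nat \<Rightarrow> nat \<Rightarrow> 'a) set"
  let ?c = "\<lambda>g. chain CARD('a) g (min n w) (CARD('a) ^ min n w)"
  let ?bad = "card {B \<in> ?M. \<not> good n w n B}"
  have M: "card ?M > 0"
    using band_nonempty by (auto simp: card_gt_0_iff)
  have upper: "card {B \<in> ?M. card (ker n B n) \<in> Y} \<le> card ?M * ?c (indicator Y) + ?bad" for Y
  proof -
    have "{B \<in> ?M. card (ker n B n) \<in> Y}
        \<subseteq> {B \<in> ?M. good n w n B \<and> card (ker n B n) \<in> Y} \<union> {B \<in> ?M. \<not> good n w n B}"
      by auto
    then have "card {B \<in> ?M. card (ker n B n) \<in> Y}
        \<le> card {B \<in> ?M. good n w n B \<and> card (ker n B n) \<in> Y} + ?bad"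
      by (intro order_trans[OF card_mono card_Un_le]) auto
    moreover have "real (card {B \<in> ?M. good n w n B \<and> card (ker n B n) \<in> Y})
        = (\<Sum>B\<in>?M. of_bool (good n w n B) * indicator Y (card (ker n B n)))"
    proof -
      have "(\<Sum>B\<in>?M. of_bool (good n w n B) * indicator Y (card (ker n B n)) :: real)
          = (\<Sum>B\<in>?M. of_bool (good n w n B \<and> card (ker n B n) \<in> Y))"
        by (intro sum.cong refl) (auto simp: indicator_def)
      then show ?thesis
        by (simp add: Int_def)
    qed
    ultimately show ?thesis
      using sum_good_le_chain[of "indicator Y" n w, where 'a = 'a] by (simp add: indicator_pos_le)
  qed
  have compl: "?c (indicator (- X)) = 1 - ?c (indicator X)"
    using chain_compl[of "CARD('a)" "indicator X"] by (simp add: indicator_compl[abs_def])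
  have "?M = {B \<in> ?M. card (ker n B n) \<in> X} \<union> {B \<in> ?M. card (ker n B n) \<in> - X}"
    by auto
  then have "card ?M = card {B \<in> ?M. card (ker n B n) \<in> X} + card {B \<in> ?M. card (ker n B n) \<in> - X}"
    by (subst card_Un_disjoint[symmetric]) auto
  then have total: "real (card ?M)
      = real (card {B \<in> ?M. card (ker n B n) \<in> X}) + real (card {B \<in> ?M. card (ker n B n) \<in> - X})"
    by (simp only: of_nat_add)
  have "\<bar>card {B \<in> ?M. card (ker n B n) \<in> X} - card ?M * ?c (indicator X)\<bar> \<le> ?bad"
    using upper[of X] upper[of "- X"] total
    unfolding compl right_diff_distrib mult_1_right abs_le_iff by linarith
  also have "real ?bad \<le> 2 * real n * card ?M / real CARD('a) ^ Suc w"
    using of_nat_mono[OF card_not_good_le[of n w, where 'a = 'a], where 'a = real]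
    by (simp only: of_nat_mult of_nat_power of_nat_numeral pos_le_divide_eq zero_less_power
        of_nat_0_less_iff zero_less_card_finite)
  finally have "\<bar>card {B \<in> ?M. card (ker n B n) \<in> X} - card ?M * ?c (indicator X)\<bar> / card ?M
      \<le> 2 * real n / real CARD('a) ^ Suc w"
    using M by (simp add: divide_le_eq)
  moreover have "card {B \<in> ?M. card (ker n B n) \<in> X} / card ?M - ?c (indicator X)
      = (card {B \<in> ?M. card (ker n B n) \<in> X} - card ?M * ?c (indicator X)) / card ?M"
  proof -
    have "real (card ?M) \<noteq> 0"
      using M by linarith
    then show ?thesis
      by (simp only: diff_divide_distrib nonzero_mult_div_cancel_left simp_thms)
  qed
  ultimately show ?thesis
    by (simp only: abs_divide abs_of_nat)
qed

subsection \<open>Coranks of uniform square matrices\<close>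

text \<open>The q-Pochhammer symbol (t; t)_m.\<close>

definition qpoch :: "real \<Rightarrow> nat \<Rightarrow> real" where
  "qpoch t m = (\<Prod>j<m. 1 - t ^ Suc j)"

lemma qpoch_0 [simp]: "qpoch t 0 = 1"
  by (simp add: qpoch_def)

lemma qpoch_Suc: "qpoch t (Suc m) = qpoch t m * (1 - t ^ Suc m)"
  by (simp add: qpoch_def)

lemma qpoch_nonzero:
  assumes "0 < t" "t < 1"
  shows "qpoch t m \<noteq> 0"
proof -
  have "1 - t ^ Suc j \<noteq> 0" for j
    using power_Suc_less_one[OF assms, of j] by linarith
  then show ?thesis
    by (simp only: qpoch_def prod_zero_iff finite_lessThan) blast
qed

(* The proportion of matrices with k-dimensional kernel among those with c rows and k + e columns. *)
definition corank_prob :: "real \<Rightarrow> nat \<Rightarrow> nat \<Rightarrow> nat \<Rightarrow> real" where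
  "corank_prob t k c e = (if e \<le> c
     then t ^ ((c - e) * k) * qpoch t c * qpoch t (k + e) / (qpoch t (c - e) * qpoch t k * qpoch t e)
     else 0)"

text \<open>With \<open>k\<close> columns, kernel dimension \<open>k\<close> means that all rows are
  zero, and each row is so with probability \<open>t ^ k\<close>.\<close>

lemma corank_prob_Suc_0:
  assumes "0 < t" "t < 1"
  shows "corank_prob t k (Suc c) 0 = t ^ k * corank_prob t k c 0"
  using qpoch_nonzero[OF assms] by (simp add: corank_prob_def power_add)

text \<open>Conditioning on one row: with \<open>k + Suc e\<close> columns it is zero with
  probability \<open>t ^ (k + Suc e)\<close>, and otherwise it cuts the dimension left by
  one.\<close>

lemma corank_prob_Suc_Suc:
  assumes t: "0 < t" "t < 1"
  shows "corank_prob t k (Suc c) (Suc e)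
    = t ^ (k + Suc e) * corank_prob t k c (Suc e) + (1 - t ^ (k + Suc e)) * corank_prob t k c e"
proof (cases "Suc e \<le> c")
  case True
  then obtain s where c: "c = Suc (e + s)"
    by (metis add_Suc le_Suc_ex)
  have ne: "qpoch t m \<noteq> 0" "1 - t ^ Suc m \<noteq> 0" for m
    using qpoch_nonzero[OF t] power_Suc_less_one[OF t, of m] by auto
  define E S Y C K where "E = t ^ Suc e" and "S = t ^ Suc s" and "Y = t ^ (s * k)"
    and "C = qpoch t c" and "K = qpoch t (k + Suc e)"
  have 1: "corank_prob t k (Suc c) (Suc e)
      = t ^ k * Y * (C * (1 - E * S)) * K / (qpoch t s * (1 - S) * qpoch t k * (qpoch t e * (1 - E)))"
    by (simp add: corank_prob_def c E_def S_def Y_def C_def K_def qpoch_Suc power_add mult_ac)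
  have 2: "corank_prob t k c (Suc e) = Y * C * K / (qpoch t s * qpoch t k * (qpoch t e * (1 - E)))"
    by (simp add: corank_prob_def c E_def Y_def C_def K_def qpoch_Suc)
  have 3: "(1 - t ^ (k + Suc e)) * corank_prob t k c e
      = t ^ k * Y * C * K / (qpoch t s * (1 - S) * qpoch t k * qpoch t e)"
    by (simp add: corank_prob_def c S_def Y_def C_def K_def qpoch_Suc power_add mult_ac)
  have 4: "t ^ (k + Suc e) = t ^ k * E"
    by (simp add: E_def power_add)
  have "1 - E \<noteq> 0" "1 - S \<noteq> 0"
    using ne by (simp_all only: E_def S_def not_False_eq_True)
  \<comment> \<open>Without the common factors the identity reads
    \<open>1 - E * S = E * (1 - S) + (1 - E)\<close>.\<close>
  then show ?thesis
    unfolding 1 2 3 unfolding 4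
    using ne(1)[of s] ne(1)[of k] ne(1)[of e] by (simp add: divide_simps) (simp add: algebra_simps)
next
  \<comment> \<open>Here \<open>c \<le> e\<close>, so the first summand vanishes; the only nonzero
    case is \<open>e = c\<close>, where every row must cut the dimension.\<close>
  case False
  then show ?thesis
    using qpoch_nonzero[OF t] power_Suc_less_one[OF t, of e]
    by (cases "e = c") (auto simp: corank_prob_def qpoch_Suc)
qed

lemma chain_pow_Suc:
  fixes q :: nat
  assumes "q > 1"
  shows "chain q g (Suc c) (q ^ Suc d)
    = (1 / q) ^ Suc d * chain q g c (q ^ Suc d) + (1 - (1 / q) ^ Suc d) * chain q g c (q ^ d)"
  using assms by (simp add: power_one_over field_simps)

text \<open>Sizes never increase along the chain, so \<open>q ^ k\<close> is out of reach from a
  smaller power.\<close>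

lemma chain_small:
  fixes q :: nat
  assumes "q > 1" and "d < k"
  shows "chain q (indicator {q ^ k}) c (q ^ d) = 0"
  using assms(2)
proof (induction c arbitrary: d)
  case 0
  then show ?case
    using assms(1) by (simp add: indicator_def)
next
  case (Suc c)
  show ?case
  proof (cases d)
    case 0
    then show ?thesis
      using Suc.IH[of 0] Suc.prems by simp
  next
    case d: (Suc d')
    have "chain q (indicator {q ^ k}) c (q ^ Suc d') = 0" "chain q (indicator {q ^ k}) c (q ^ d') = 0"
      using Suc.prems d by (intro Suc.IH; simp)+
    then show ?thesis
      unfolding d chain_pow_Suc[OF assms(1)] by (simp only: mult_zero_right add_0)
  qed
qed

text \<open>Both sides obey the same recursion. For \<open>e = 0\<close> the downward branch
  contributes nothing: it falls below \<open>q ^ k\<close>, or has weight 0 when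
  \<open>k = 0\<close>.\<close>

lemma chain_eq_corank_prob:
  fixes q :: nat
  assumes q: "q > 1"
  shows "chain q (indicator {q ^ k}) c (q ^ (k + e)) = corank_prob (1 / q) k c e"
proof (induction c arbitrary: e)
  case 0
  have "qpoch (1 / q) k \<noteq> 0"
    using q by (intro qpoch_nonzero) auto
  then show ?case
    using q by (auto simp: corank_prob_def indicator_def)
next
  case (Suc c)
  have t: "0 < 1 / real q" "1 / real q < 1"
    using q by auto
  show ?case
  proof (cases e)
    case 0
    show ?thesis
    proof (cases k)
      case 0
      then show ?thesis
        using Suc.IH[of 0] corank_prob_Suc_0[OF t, of k c] \<open>e = 0\<close> by simp
    next
      case k: (Suc k')
      have "chain q (indicator {q ^ Suc k'}) c (q ^ k') = 0"
        by (rule chain_small[OF q lessI])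
      moreover have "chain q (indicator {q ^ Suc k'}) c (q ^ Suc k') = corank_prob (1 / q) k c 0"
        using Suc.IH[of 0] unfolding k add_0_right .
      ultimately show ?thesis
        unfolding \<open>e = 0\<close> corank_prob_Suc_0[OF t]
        unfolding k add_0_right chain_pow_Suc[OF q] by (simp only: mult_zero_right add_0_right)
    qed
  next
    case e: (Suc e')
    show ?thesis
      unfolding e corank_prob_Suc_Suc[OF t] Suc.IH[symmetric]
      unfolding add_Suc_right chain_pow_Suc[OF q] ..
  qed
qed

section \<open>Limit of the closed form\<close>

lemma qpoch_LIMSEQ:
  assumes t: "0 < t" "t < 1"
  shows "qpoch t \<longlonglongrightarrow> (\<Prod>j. 1 - t ^ Suc j)" and "(\<Prod>j. 1 - t ^ Suc j) \<noteq> 0"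
proof -
  have "summable (\<lambda>j. norm ((1 - t ^ Suc j) - 1))"
    using t by (simp add: abs_mult summable_mult summable_geometric)
  then have conv: "convergent_prod (\<lambda>j. 1 - t ^ Suc j)"
    by (intro abs_convergent_prod_imp_convergent_prod summable_imp_abs_convergent_prod)
  then have "(\<lambda>n. \<Prod>j\<le>n. 1 - t ^ Suc j) \<longlonglongrightarrow> (\<Prod>j. 1 - t ^ Suc j)"
    by (rule convergent_prod_LIMSEQ)
  then show "qpoch t \<longlonglongrightarrow> (\<Prod>j. 1 - t ^ Suc j)"
    unfolding qpoch_def[abs_def] by (simp only: LIMSEQ_lessThan_iff_atMost)
  \<comment> \<open>No factor vanishes, so the infinite product is nonzero, which later permits a
    quotient of limits.\<close>
  have "1 - t ^ Suc j \<noteq> 0" for j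
    using power_Suc_less_one[OF t, of j] by simp
  then show "(\<Prod>j. 1 - t ^ Suc j) \<noteq> 0"
    by (intro prodinf_nonzero conv)
qed

lemma chain_LIMSEQ:
  fixes q :: nat
  assumes q: "q > 1"
  shows "(\<lambda>m. chain q (indicator {q ^ k}) m (q ^ m))
    \<longlonglongrightarrow> (1 / q) ^ (k ^ 2) / qpoch (1 / q) k ^ 2 * (\<Prod>j. 1 - (1 / real q) ^ Suc j)"
proof (rule LIMSEQ_offset[where k = k])
  let ?t = "1 / real q"
  have t: "0 < ?t" "?t < 1"
    using q by auto
  let ?L = "\<Prod>j. 1 - ?t ^ Suc j"
  note L = qpoch_LIMSEQ[OF t]
  \<comment> \<open>After the shift by \<open>k\<close> the start is dimension \<open>k\<close> with
    excess \<open>e = m\<close> and \<open>c = m + k\<close> steps, so \<open>c - e\<close> is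
    exactly \<open>k\<close>.\<close>
  have "chain q (indicator {q ^ k}) (m + k) (q ^ (m + k))
      = ?t ^ (k ^ 2) / qpoch ?t k ^ 2 * (qpoch ?t (m + k) * qpoch ?t (m + k) / qpoch ?t m)" for m
    using chain_eq_corank_prob[OF q, of k "m + k" m]
    by (simp add: corank_prob_def add.commute power2_eq_square)
  moreover have "(\<lambda>m. ?t ^ (k ^ 2) / qpoch ?t k ^ 2 * (qpoch ?t (m + k) * qpoch ?t (m + k) / qpoch ?t m))
      \<longlonglongrightarrow> ?t ^ (k ^ 2) / qpoch ?t k ^ 2 * (?L * ?L / ?L)"
    by (intro tendsto_intros L LIMSEQ_ignore_initial_segment)
  ultimately show "(\<lambda>m. chain q (indicator {q ^ k}) (m + k) (q ^ (m + k)))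
      \<longlonglongrightarrow> ?t ^ (k ^ 2) / qpoch ?t k ^ 2 * ?L"
    using L(2) by simp
qed

subsection \<open>Transfer to matrices\<close>

definition mat_fun :: "nat \<Rightarrow> 'a :: zero mat \<Rightarrow> nat \<Rightarrow> nat \<Rightarrow> 'a" where
  "mat_fun n A = (\<lambda>i j. if i < n \<and> j < n then A $$ (i, j) else 0)"

lemma bij_betw_mat_fun: "bij_betw (mat_fun n) (band_mats n w) (band n w)"
proof (rule bij_betwI[where g = "\<lambda>B. mat n n (\<lambda>(i, j). B i j)"])
  have far: "\<bar>int i - int j\<bar> > int w \<longleftrightarrow> \<not> (i \<le> j + w \<and> j \<le> i + w)" for i j
    by linarith
  show "mat_fun n \<in> band_mats n w \<rightarrow> band n w"
    by (auto simp: mat_fun_def band_mats_def band_iff window_def far)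
  show "(\<lambda>B. mat n n (\<lambda>(i, j). B i j)) \<in> band n w \<rightarrow> band_mats n w"
    by (auto simp: band_mats_def band_iff window_def far)
  show "mat n n (\<lambda>(i, j). mat_fun n A i j) = A" if "A \<in> band_mats n w" for A
    using that by (intro eq_matI) (auto simp: mat_fun_def band_mats_def)
  show "mat_fun n (mat n n (\<lambda>(i, j). B i j)) = B" if "B \<in> band n w" for B
    using that by (auto simp: fun_eq_iff mat_fun_def band_iff window_def)
qed

lemma card_ker_mat_fun:
  fixes A :: "'a :: {field, finite} mat"
  assumes A: "A \<in> carrier_mat n n"
  shows "card (ker n (mat_fun n A) n) = CARD('a) ^ kernel_dim A"
proof -
  have dot: "dot {..<n} (mat_fun n A i) v = row A i \<bullet> vec n v" if "i < n" for i v
    using that A by (auto simp: dot_def mat_fun_def scalar_prod_def lessThan_atLeast0)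
  have mem: "v \<in> ker n (mat_fun n A) n \<longleftrightarrow> v \<in> supported {..<n} \<and> vec n v \<in> mat_kernel A" for v
    using A by (auto simp: ker_def mat_kernel dot vec_eq_iff)
  have "bij_betw (vec n) (ker n (mat_fun n A) n) (mat_kernel A)"
  proof (rule bij_betwI[where g = "\<lambda>u j. if j < n then u $ j else 0"])
    show "vec n \<in> ker n (mat_fun n A) n \<rightarrow> mat_kernel A"
      by (simp add: mem)
    have vec: "vec n (\<lambda>j. if j < n then u $ j else 0) = u" if "u \<in> mat_kernel A" for u
      using mat_kernelD[OF A that] by (intro eq_vecI) auto
    then show "vec n (\<lambda>j. if j < n then u $ j else 0) = u" if "u \<in> mat_kernel A" for u
      using that .
    show "(\<lambda>u j. if j < n then u $ j else 0) \<in> mat_kernel A \<rightarrow> ker n (mat_fun n A) n"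
      using vec by (auto simp: mem supported_def)
    show "(\<lambda>j. if j < n then vec n v $ j else 0) = v" if "v \<in> ker n (mat_fun n A) n" for v
      using that by (auto simp: mem supported_def fun_eq_iff)
  qed
  then have "card (ker n (mat_fun n A) n) = card (mat_kernel A)"
    by (rule bij_betw_same_card)
  also have "\<dots> = CARD('a) ^ kernel_dim A"
    using kernel.card_mat_kernel[OF kernel.intro[OF A]] kernel.kernel_dim[OF kernel.intro[OF A]] by simp
  finally show ?thesis .
qed

lemma prob_kernel_dim_band_mats:
  fixes n w k :: nat
  defines "M \<equiv> band_mats n w :: 'a :: {field, finite} mat set"
  shows "measure_pmf.prob (pmf_of_set M) {B. kernel_dim B = k}
    = card {B \<in> band n w :: (nat \<Rightarrow> nat \<Rightarrow> 'a) set. card (ker n B n) \<in> {CARD('a) ^ k}}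
      / card (band n w :: (nat \<Rightarrow> nat \<Rightarrow> 'a) set)"
proof -
  have "CARD('a) > 1"
    using card_mono[of "UNIV :: 'a set" "{0, 1}"] by simp
  \<comment> \<open>As the field has more than one element, the size of the kernel determines its
    dimension.\<close>
  then have dim: "card (ker n (mat_fun n A) n) \<in> {CARD('a) ^ k} \<longleftrightarrow> kernel_dim A = k" if "A \<in> M" for A
    using that by (simp add: M_def band_mats_def card_ker_mat_fun)
  have bij: "bij_betw (mat_fun n) M (band n w)"
    unfolding M_def by (rule bij_betw_mat_fun)
  have bij': "bij_betw (mat_fun n) (M \<inter> {B. kernel_dim B = k})
      {B \<in> band n w. card (ker n B n) \<in> {CARD('a) ^ k}}"
  proof (rule bij_betw_subset[OF bij])
    show "mat_fun n ` (M \<inter> {B. kernel_dim B = k}) = {B \<in> band n w. card (ker n B n) \<in> {CARD('a) ^ k}}"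
      unfolding bij_betw_imp_surj_on[OF bij, symmetric] using dim by blast
  qed blast
  then show ?thesis
    using bij_betw_same_card[OF bij] bij_betw_same_card[OF bij']
    unfolding M_def by (subst measure_pmf_of_set) (auto simp: band_mats_nonempty finite_band_mats)
qed

section \<open>Decay of the error term and the limit\<close>

lemma band_width_LIMSEQ:
  fixes w :: "nat \<Rightarrow> nat" and p :: real
  assumes p: "p > 1" and lim: "filterlim (\<lambda>n. real (w n) - log p (real n)) at_top sequentially"
  shows "filterlim (\<lambda>n. min n (w n)) at_top sequentially"
    and "(\<lambda>n. 2 * real n / p ^ Suc (w n)) \<longlonglongrightarrow> 0"
proof -
  have "filterlim (\<lambda>n. real (w n)) at_top sequentially"
  proof (rule filterlim_at_top_mono[OF lim])
    show "\<forall>\<^sub>F n in sequentially. real (w n) - log p (real n) \<le> real (w n)"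
      using eventually_ge_at_top[of 1] by eventually_elim (use p in simp)
  qed
  then have "filterlim w at_top sequentially"
    by (simp add: filterlim_sequentially_iff_filterlim_real)
  then show "filterlim (\<lambda>n. min n (w n)) at_top sequentially"
    unfolding filterlim_at_top by (auto intro: eventually_conj eventually_ge_at_top)
  have "((\<lambda>x. p powr (- x)) \<longlongrightarrow> 0) at_top"
    using p by real_asymp
  from filterlim_compose[OF this lim]
  have "(\<lambda>n. p powr (- (real (w n) - log p (real n)))) \<longlonglongrightarrow> 0" .
  then have "(\<lambda>n. 2 / p * p powr (- (real (w n) - log p (real n)))) \<longlonglongrightarrow> 2 / p * 0"
    by (intro tendsto_intros)
  \<comment> \<open>For \<open>n \<ge> 1\<close> raising \<open>p\<close> to \<open>log p n\<close>
    gives \<open>n\<close>, so the error is a constant times a power of \<open>p\<close> whose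
    exponent tends to minus infinity.\<close>
  moreover have "\<forall>\<^sub>F n in sequentially. 2 / p * p powr (- (real (w n) - log p (real n))) = 2 * real n / p ^ Suc (w n)"
    using eventually_ge_at_top[of 1]
    by eventually_elim (use p in \<open>simp add: powr_diff powr_realpow field_simps\<close>)
  ultimately show "(\<lambda>n. 2 * real n / p ^ Suc (w n)) \<longlonglongrightarrow> 0"
    by (simp add: tendsto_cong)
qed

theorem theorem2:
  fixes p :: nat and w :: "nat \<Rightarrow> nat" and k :: nat
  assumes "prime p" and "CARD('p :: prime_card) = p"
    and "\<And>n. n \<ge> 1 \<Longrightarrow> w n > 0"
    and "filterlim (\<lambda>n. real (w n) - log (real p) (real n)) at_top sequentially"
  shows "(\<lambda>n. measure_pmf.prob (pmf_of_set (band_mats n (w n) :: 'p mod_ring mat set))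
             {B. kernel_dim B = k})
         \<longlonglongrightarrow> real p powi (- int (k ^ 2))
           * (\<Prod>j = 1..k. (1 - real p powi (- int j)) powi (- 2))
           * (\<Prod>j. 1 - real p powi (- int (Suc j)))"
proof -
  have p: "p > 1"
    using assms(1) by (rule prime_gt_1_nat)
  have card: "CARD('p mod_ring) = p"
    using assms(2) by simp
  let ?P = "\<lambda>n. measure_pmf.prob (pmf_of_set (band_mats n (w n) :: 'p mod_ring mat set)) {B. kernel_dim B = k}"
  let ?c = "\<lambda>m. chain p (indicator {p ^ k}) m (p ^ m)"
  have "real p > 1"
    using p by simp
  note w = band_width_LIMSEQ[OF this assms(4)]
  have "norm (?P n - ?c (min n (w n))) \<le> 2 * real n / real p ^ Suc (w n)" for n
    using band_kernel_prob_approx[of n "w n" "{p ^ k}", where 'a = "'p mod_ring"]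
    unfolding prob_kernel_dim_band_mats card by simp
  then have diff: "(\<lambda>n. ?P n - ?c (min n (w n))) \<longlonglongrightarrow> 0"
    by (intro Lim_null_comparison[OF _ w(2)] always_eventually allI)
  have "(\<lambda>n. ?c (min n (w n)))
      \<longlonglongrightarrow> (1 / p) ^ (k ^ 2) / qpoch (1 / p) k ^ 2 * (\<Prod>j. 1 - (1 / real p) ^ Suc j)"
    by (rule filterlim_compose[OF chain_LIMSEQ[OF p] w(1)])
  from tendsto_add[OF diff this]
  have lim: "?P \<longlonglongrightarrow> (1 / p) ^ (k ^ 2) / qpoch (1 / p) k ^ 2 * (\<Prod>j. 1 - (1 / real p) ^ Suc j)"
    by (simp only: diff_add_cancel add_0_left)
  have pow: "real p powi (- int m) = (1 / p) ^ m" for m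
    by (simp add: power_int_minus power_one_over inverse_eq_divide)
  have "(\<Prod>j = 1..k. (1 - (1 / real p) ^ j) powi (- 2)) = (\<Prod>j = 1..k. 1 / (1 - (1 / real p) ^ j) ^ 2)"
    by (intro prod.cong refl) (simp only: power_int_minus power_int_numeral inverse_eq_divide)
  also have "\<dots> = 1 / (\<Prod>j = 1..k. 1 - (1 / real p) ^ j) ^ 2"
    by (simp only: prod_dividef prod_power_distrib prod.neutral_const)
  also have "(\<Prod>j = 1..k. 1 - (1 / real p) ^ j) = qpoch (1 / p) k"
    unfolding qpoch_def by (rule prod.reindex_bij_witness[of _ Suc "\<lambda>j. j - 1"]) auto
  finally have prod: "(\<Prod>j = 1..k. (1 - (1 / real p) ^ j) powi (- 2)) = 1 / qpoch (1 / p) k ^ 2" .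
  show ?thesis
    using lim unfolding pow prod by (simp only: times_divide_eq_right mult_1_right)
qed

end
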